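(* Let $m$ and $n$ be nonnegative integers with $m\le n$. Then the sum $$\sum_{k=0}^{n-m} (-1)^k q^{\frac{k(k-1)}{2}} \frac{1}{(-q;q)_{n-k}} \begin{bmatrix} n-m\\ k\end{bmatrix}_q T_{n-k,m}(q)$$ is equal to $$\frac{q^{(n^2-m^2)/2}}{(-q;q)_{(n-m)/2}\,(-q;q)_{(n+m)/2}} \begin{bmatrix} 2m\\ m\end{bmatrix}_q \begin{bmatrix} n\\ m\end{bmatrix}_q^{-1} \begin{bmatrix} n\\ (n-m)/2\end{bmatrix}_q$$ if $n-m$ is even, and is equal to $0$ if $n-m$ is odd.
   Context: $q$ is an indeterminate; identities are in the field of rational functions in $q$. $(a;q)_0=1$ and $(a;q)_n=\prod_{k=0}^{n-1}(1-aq^k)$ for $n\ge 1$. $[i]_q=\frac{1-q^i}{1-q}$, $[k]_q!=\prod_{i=1}^k [i]_q$, and $\begin{bmatrix} n\\k\end{bmatrix}_q=\frac{[n]_q!}{[k]_q![n-k]_q!}$ for $0\le k\le n$. The $q$-super Catalan numbers are, for nonnegative integers $n,m$, $T_{n,m}(q)=\frac{[2m]_q!\,[2n]_q!}{[m]_q!\,[n]_q!\,[m+n]_q!}$. *)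

theory Defs
  imports "HOL-Computational_Algebra.Polynomial" "HOL-Computational_Algebra.Fraction_Field"
begin

text \<open>
  The \<open>q\<close>-analogues are defined with \<open>q\<close> as an explicit parameter in an arbitrary field. The
  intended instance is \<open>indet\<close>, the indeterminate of a field of rational functions; it is not a
  root of unity and not zero, so no denominator below vanishes there.
\<close>

definition indet :: "'a::field_char_0 poly fract" where
  "indet = Fract [:0, 1:] 1"

definition qpoch :: "'a::field \<Rightarrow> 'a \<Rightarrow> nat \<Rightarrow> 'a" where
  "qpoch a q n = (\<Prod>k<n. 1 - a * q ^ k)"

definition qbracket :: "'a::field \<Rightarrow> nat \<Rightarrow> 'a" where
  "qbracket q i = (1 - q ^ i) / (1 - q)"

definition qfact :: "'a::field \<Rightarrow> nat \<Rightarrow> 'a" where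
  "qfact q k = (\<Prod>i=1..k. qbracket q i)"

text \<open>Without the guard, truncated subtraction would give a nonzero value for \<open>k > n\<close>.\<close>

definition qbinom :: "'a::field \<Rightarrow> nat \<Rightarrow> nat \<Rightarrow> 'a" where
  "qbinom q n k = (if k \<le> n then qfact q n / (qfact q k * qfact q (n - k)) else 0)"

definition qsuper_catalan :: "'a::field \<Rightarrow> nat \<Rightarrow> nat \<Rightarrow> 'a" where
  "qsuper_catalan q n m =
     (qfact q (2 * m) * qfact q (2 * n)) / (qfact q m * qfact q n * qfact q (m + n))"

end

theory Submission
  imports Defs
begin

text \<open>
  Let \<open>S\<close> be the shift of sequences and \<open>\<Delta>\<^sub>N c = ((S - q\<^bsup>N-1\<^esup>) \<dots> (S - q) (S - 1) c) 0\<close>.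
  By the \<open>q\<close>-Pascal rule the sum in question is, up to the factor \<open>[2m]!/[m]!\<close>, the value
  \<open>G(N, m) = \<Delta>\<^sub>N c\<close> for \<open>N = n - m\<close> and \<open>c\<^sub>j = [1] [3] \<dots> [2(m+j)-1] / [2m+j]!\<close>. Applying \<open>S - 1\<close>
  to \<open>c\<close> produces a factor \<open>q\<^bsup>2m+1+j\<^esup> [j]\<close>; pulling \<open>q\<^sup>j\<close> and then \<open>[j]\<close> out of \<open>\<Delta>\<close> lowers its
  order by one each time and gives \<open>G(N+2, m) = q\<^bsup>N+2m+2\<^esup> [N+1] G(N, m+1)\<close>. Together with
  \<open>G(1, m) = 0\<close> and the value of \<open>G(0, m)\<close> this determines \<open>G\<close>.
\<close>

section \<open>Iterated q-differences\<close>

primrec qdiff :: "'a::field \<Rightarrow> nat \<Rightarrow> (nat \<Rightarrow> 'a) \<Rightarrow> 'a" where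
  "qdiff q 0 c = c 0"
| "qdiff q (Suc N) c = qdiff q N (\<lambda>j. c (Suc j)) - q ^ N * qdiff q N c"

text \<open>The q-analogue of the double factorial (2n-1)!!.\<close>

definition qoddfact :: "'a::field \<Rightarrow> nat \<Rightarrow> 'a" where
  "qoddfact q n = (\<Prod>i<n. qbracket q (2 * i + 1))"

lemma qdiff_cmult: "qdiff q N (\<lambda>j. a * c j) = a * qdiff q N c"
  by (induction N arbitrary: c) (simp_all add: algebra_simps)

lemma qdiff_add: "qdiff q N (\<lambda>j. c j + d j) = qdiff q N c + qdiff q N d"
  by (induction N arbitrary: c d) (simp_all add: algebra_simps)

text \<open>Moving \<open>S - q^i\<close> past multiplication by \<open>q^j\<close> turns it into
  \<open>q * (S - q^(i-1))\<close>. Once \<open>S - 1\<close> has been applied to \<open>c\<close>,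
  the remaining N factors thus become those of \<open>qdiff q N\<close>, and each contributes one
  \<open>q\<close>.\<close>

lemma qdiff_Suc_diff:
  assumes "\<And>j. c (Suc j) - c j = q ^ j * d j"
  shows "qdiff q (Suc N) c = q ^ N * qdiff q N d"
  using assms
proof (induction N arbitrary: c d)
  case 0
  then show ?case using 0[of 0] by simp
next
  case (Suc N)
  have "qdiff q (Suc N) (\<lambda>j. c (Suc j)) = q ^ N * qdiff q N (\<lambda>j. q * d (Suc j))"
    by (rule Suc.IH) (simp add: Suc.prems algebra_simps)
  moreover have "qdiff q (Suc N) c = q ^ N * qdiff q N d"
    by (rule Suc.IH) (rule Suc.prems)
  ultimately have "qdiff q (Suc (Suc N)) c
      = q ^ N * (q * qdiff q N (\<lambda>j. d (Suc j))) - q ^ Suc N * (q ^ N * qdiff q N d)"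
    by (simp only: qdiff.simps(2)[of q "Suc N"] qdiff_cmult)
  then show ?case by (simp add: algebra_simps)
qed

section \<open>Recursions of the q-analogues and nonvanishing denominators\<close>

lemma qbracket_0 [simp]: "qbracket q 0 = 0"
  by (simp add: qbracket_def)

lemma qfact_0 [simp]: "qfact q 0 = 1"
  by (simp add: qfact_def)

lemma qfact_Suc: "qfact q (Suc n) = qfact q n * qbracket q (Suc n)"
  by (simp add: qfact_def)

lemma qpoch_0 [simp]: "qpoch a q 0 = 1"
  by (simp add: qpoch_def)

lemma qpoch_Suc: "qpoch a q (Suc n) = qpoch a q n * (1 - a * q ^ n)"
  by (simp add: qpoch_def)

lemma qoddfact_0 [simp]: "qoddfact q 0 = 1"
  by (simp add: qoddfact_def)

lemma qoddfact_Suc: "qoddfact q (Suc n) = qoddfact q n * qbracket q (Suc (2 * n))"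
  by (simp add: qoddfact_def)

lemma indet_power_neq_1:
  assumes "i > 0"
  shows "(indet :: 'a::field_char_0 poly fract) ^ i \<noteq> 1"
proof -
  have "(indet :: 'a poly fract) ^ i = Fract ([:0, 1:] ^ i) 1"
    by (induction i) (simp_all add: indet_def One_fract_def)
  moreover have "([:0, 1:] :: 'a poly) ^ i \<noteq> 1"
    using assms by (metis degree_1 degree_linear_power less_numeral_extra(3))
  ultimately show ?thesis
    by (simp add: One_fract_def eq_fract)
qed

context
  fixes q :: "'a::field"
  assumes not_root_of_unity: "\<And>i. i > 0 \<Longrightarrow> q ^ i \<noteq> 1"
begin

lemma q_neq_1: "q \<noteq> 1"
  using not_root_of_unity[of 1] by simp

lemma qbracket_neq_0: "i > 0 \<Longrightarrow> qbracket q i \<noteq> 0"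
  using not_root_of_unity[of i] q_neq_1 by (simp add: qbracket_def)

lemma qfact_neq_0: "qfact q n \<noteq> 0"
  by (simp add: qfact_def qbracket_neq_0)

text \<open>A vanishing factor would give \<open>q^(k+1) = -1\<close>, and squaring would make
  \<open>q\<close> a root of unity.\<close>

lemma qpoch_neg_neq_0: "qpoch (- q) q n \<noteq> 0"
proof -
  have "1 - - q * q ^ k \<noteq> 0" for k
  proof
    assume "1 - - q * q ^ k = 0"
    then have "q ^ Suc k = - 1"
      by (simp add: eq_neg_iff_add_eq_0 add.commute)
    then have "q ^ (Suc k * 2) = 1"
      by (simp only: power_mult) simp
    then show False using not_root_of_unity[of "Suc k * 2"] by simp
  qed
  then show ?thesis by (simp add: qpoch_def)
qed

lemma qbracket_add: "qbracket q (i + j) = qbracket q i + q ^ i * qbracket q j"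
  by (simp add: qbracket_def power_add add_divide_distrib[symmetric]) (simp add: algebra_simps)

lemma qbracket_1 [simp]: "qbracket q (Suc 0) = 1"
  using q_neq_1 by (simp add: qbracket_def)

text \<open>A q-Leibniz rule for the linear factor \<open>[j]\<close>, evaluated at j = 0, where the
  undifferentiated term dies because \<open>[0] = 0\<close>.\<close>

lemma qdiff_Suc_qbracket:
  "qdiff q (Suc N) (\<lambda>j. qbracket q j * e j) = qbracket q (Suc N) * qdiff q N (\<lambda>j. e (Suc j))"
proof (induction N arbitrary: e)
  case 0
  then show ?case by simp
next
  case (Suc N)
  have "qdiff q (Suc N) (\<lambda>j. qbracket q (Suc j) * e (Suc j))
      = qdiff q (Suc N) (\<lambda>j. e (Suc j) + q * (qbracket q j * e (Suc j)))"
    using qbracket_add[of "Suc 0"] by (simp add: algebra_simps)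
  also have "\<dots> = qdiff q (Suc N) (\<lambda>j. e (Suc j))
      + q * (qbracket q (Suc N) * qdiff q N (\<lambda>j. e (Suc (Suc j))))"
    by (simp only: qdiff_add qdiff_cmult Suc.IH[of "\<lambda>j. e (Suc j)"])
  finally have "qdiff q (Suc (Suc N)) (\<lambda>j. qbracket q j * e j)
      = qdiff q (Suc N) (\<lambda>j. e (Suc j))
      + q * (qbracket q (Suc N) * qdiff q N (\<lambda>j. e (Suc (Suc j))))
      - q ^ Suc N * (qbracket q (Suc N) * qdiff q N (\<lambda>j. e (Suc j)))"
    by (simp only: qdiff.simps(2)[of q "Suc N"] Suc.IH)
  \<comment> \<open>The last two terms share the factor \<open>q * [N+1]\<close>; what remains of
    them is the recursion for \<open>qdiff q (Suc N)\<close> of the shifted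
    \<open>e\<close>.\<close>
  also have "\<dots> = (1 + q * qbracket q (Suc N)) * qdiff q (Suc N) (\<lambda>j. e (Suc j))"
    by (simp add: algebra_simps)
  also have "1 + q * qbracket q (Suc N) = qbracket q (Suc (Suc N))"
    using qbracket_add[of "Suc 0" "Suc N"] by simp
  finally show ?case .
qed

section \<open>Expansion of the q-difference in q-binomial coefficients\<close>

lemma qbinom_0: "qbinom q n 0 = 1"
  using qfact_neq_0 by (simp add: qbinom_def)

text \<open>Comes from \<open>[n+1] = [n-k] + q^(n-k) [k+1]\<close>. Of the two q-Pascal rules, this
  one has the power that fits the exponent identity in \<open>qdiff_eq_sum\<close>.\<close>

lemma qbinom_Suc_Suc:
  assumes "k \<le> n"
  shows "qbinom q (Suc n) (Suc k) = qbinom q n (Suc k) + q ^ (n - k) * qbinom q n k"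
proof (cases "k = n")
  case True
  then show ?thesis using qfact_neq_0 by (simp add: qbinom_def)
next
  case False
  then obtain d where n: "n = Suc (k + d)"
    using assms by (metis add_Suc_right le_neq_implies_less less_iff_Suc_add)
  have bracket: "qbracket q (Suc n) = qbracket q (Suc d) + q ^ Suc d * qbracket q (Suc k)"
    using qbracket_add[of "Suc d" "Suc k"] by (simp add: n add.commute)
  show ?thesis
    using qfact_neq_0[of k] qfact_neq_0[of d] qbracket_neq_0[of "Suc k"] qbracket_neq_0[of "Suc d"]
    by (simp add: qbinom_def n qfact_Suc[of q "Suc (k + d)"] qfact_Suc[of q k] qfact_Suc[of q d]
        bracket[unfolded n] Suc_diff_le divide_simps) (simp add: algebra_simps)
qed

text \<open>The q-binomial theorem for the product of the \<open>S - q^i\<close> with i < N, where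
  \<open>S^(N-k)\<close> is read as \<open>c (N - k)\<close>.\<close>

lemma qdiff_eq_sum:
  "qdiff q N c = (\<Sum>k=0..N. (-1) ^ k * q ^ (k * (k - 1) div 2) * qbinom q N k * c (N - k))"
proof (induction N arbitrary: c)
  case 0
  then show ?case by (simp add: qbinom_0)
next
  case (Suc N)
  define a where "a N k = (-1) ^ k * q ^ (k * (k - 1) div 2) * qbinom q N k" for N k
  have a0: "a N 0 = 1" for N by (simp add: a_def qbinom_0)
  \<comment> \<open>The guard in \<open>qbinom\<close> lets a sum over k up to N be extended to N +
    1, as the shift of index requires.\<close>
  have a_last: "a N (Suc N) = 0" by (simp add: a_def qbinom_def)
  have a_Suc: "a (Suc N) (Suc k) = a N (Suc k) - q ^ N * a N k" if "k \<le> N" for k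
  proof -
    have "Suc k * k = k * (k - 1) + k * 2" by (cases k) simp_all
    then have "Suc k * k div 2 + (N - k) = k * (k - 1) div 2 + N"
      using that by simp
    then have "q ^ (Suc k * k div 2) * q ^ (N - k) = q ^ (k * (k - 1) div 2) * q ^ N"
      by (simp only: power_add[symmetric])
    then show ?thesis
      unfolding a_def qbinom_Suc_Suc[OF that] by (simp add: algebra_simps)
  qed
  have "(\<Sum>k=0..Suc N. a (Suc N) k * c (Suc N - k))
      = c (Suc N) + (\<Sum>k=0..N. a (Suc N) (Suc k) * c (N - k))"
    by (subst sum.atLeast0_atMost_Suc_shift) (simp add: a0)
  also have "(\<Sum>k=0..N. a (Suc N) (Suc k) * c (N - k))
      = (\<Sum>k=0..N. a N (Suc k) * c (N - k)) - q ^ N * (\<Sum>k=0..N. a N k * c (N - k))"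
    by (simp add: a_Suc sum_subtractf sum_distrib_left algebra_simps)
  also have "c (Suc N) + ((\<Sum>k=0..N. a N (Suc k) * c (N - k)) - q ^ N * (\<Sum>k=0..N. a N k * c (N - k)))
      = (\<Sum>k=0..Suc N. a N k * c (Suc N - k)) - q ^ N * (\<Sum>k=0..N. a N k * c (N - k))"
    by (subst sum.atLeast0_atMost_Suc_shift) (simp add: a0)
  also have "(\<Sum>k=0..Suc N. a N k * c (Suc N - k)) = (\<Sum>k=0..N. a N k * c (Suc (N - k)))"
    by (simp add: a_last Suc_diff_le)
  finally show ?case
    by (simp only: qdiff.simps Suc.IH a_def)
qed

section \<open>Evaluation of the differences\<close>

lemma qfact_double: "qfact q (2 * n) = qoddfact q n * qpoch (- q) q n * qfact q n"
proof (induction n)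
  case 0
  then show ?case by simp
next
  case (Suc n)
  \<comment> \<open>The even brackets split as \<open>[2i] = [i] (1 + q^i)\<close>, which yields the
    q-Pochhammer symbol and \<open>[n]!\<close>.\<close>
  have "Suc (Suc (2 * n)) = Suc n + Suc n" by simp
  then have "qbracket q (Suc (Suc (2 * n))) = qbracket q (Suc n) * (1 - - q * q ^ n)"
    by (simp only: qbracket_add) (simp add: algebra_simps)
  then show ?case using Suc
    by (simp add: qfact_Suc qpoch_Suc qoddfact_Suc)
qed

lemma qdiff_qoddfact_Suc_Suc:
  "qdiff q (Suc (Suc N)) (\<lambda>j. qoddfact q (m + j) / qfact q (2 * m + j))
    = q ^ (N + 2 * m + 2) * qbracket q (Suc N)
      * qdiff q N (\<lambda>j. qoddfact q (Suc m + j) / qfact q (2 * Suc m + j))"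
proof -
  \<comment> \<open>The denominator of \<open>e\<close> is the common denominator of two consecutive
    terms; shifted by one, \<open>e\<close> is the original sequence with m + 1 for m.\<close>
  define e where "e j = qoddfact q (m + j) / qfact q (Suc (2 * m + j))" for j
  have "qoddfact q (m + Suc j) / qfact q (2 * m + Suc j) - qoddfact q (m + j) / qfact q (2 * m + j)
      = q ^ j * (q ^ (2 * m + 1) * (qbracket q j * e j))" for j
  proof -
    have "qbracket q (Suc (2 * (m + j)))
        = qbracket q (Suc (2 * m + j)) + q ^ (Suc (2 * m + j)) * qbracket q j"
      using qbracket_add[of "Suc (2 * m + j)" j] by (simp add: algebra_simps mult_2)
    then show ?thesis
      using qfact_neq_0[of "2 * m + j"] qbracket_neq_0[of "Suc (2 * m + j)"]
      by (simp add: e_def qfact_Suc qoddfact_Suc divide_simps) (simp add: algebra_simps power_add)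
  qed
  then have "qdiff q (Suc (Suc N)) (\<lambda>j. qoddfact q (m + j) / qfact q (2 * m + j))
      = q ^ Suc N * qdiff q (Suc N) (\<lambda>j. q ^ (2 * m + 1) * (qbracket q j * e j))"
    by (rule qdiff_Suc_diff)
  also have "\<dots> = q ^ (N + 2 * m + 2) * qbracket q (Suc N) * qdiff q N (\<lambda>j. e (Suc j))"
    by (simp only: qdiff_cmult qdiff_Suc_qbracket) (simp add: power_add)
  finally show ?thesis by (simp add: e_def)
qed

text \<open>Each of the a reductions keeps a + m fixed and contributes \<open>q^(2(a+m))\<close>,
  while the odd brackets accumulate to \<open>qoddfact q a\<close>.\<close>

lemma qdiff_qoddfact_even:
  "qdiff q (2 * a) (\<lambda>j. qoddfact q (m + j) / qfact q (2 * m + j))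
    = q ^ (2 * a * (a + m)) * qoddfact q a / (qpoch (- q) q (a + m) * qfact q (a + m))"
proof (induction a arbitrary: m)
  case 0
  then show ?case
    using qfact_neq_0[of "2 * m"] by (simp add: qfact_double)
next
  case (Suc a)
  have "2 * Suc a * (Suc a + m) = (2 * a + 2 * m + 2) + 2 * a * (a + Suc m)"
    by (simp add: algebra_simps)
  then have "q ^ (2 * Suc a * (Suc a + m)) = q ^ (2 * a + 2 * m + 2) * q ^ (2 * a * (a + Suc m))"
    by (simp only: power_add)
  moreover have "qdiff q (2 * Suc a) (\<lambda>j. qoddfact q (m + j) / qfact q (2 * m + j))
      = q ^ (2 * a + 2 * m + 2) * qbracket q (Suc (2 * a))
        * (q ^ (2 * a * (a + Suc m)) * qoddfact q a
          / (qpoch (- q) q (a + Suc m) * qfact q (a + Suc m)))"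
    using qdiff_qoddfact_Suc_Suc[of "2 * a" m] Suc.IH[of "Suc m"] by simp
  ultimately show ?case
    by (simp only: qoddfact_Suc add_Suc_shift times_divide_eq_right mult_ac)
qed

text \<open>The reduction ends at order 1, where both terms agree: their ratio is
  \<open>[2m+1] / [2m+1]\<close>.\<close>

lemma qdiff_qoddfact_odd:
  "qdiff q (Suc (2 * a)) (\<lambda>j. qoddfact q (m + j) / qfact q (2 * m + j)) = 0"
proof (induction a arbitrary: m)
  case 0
  then show ?case
    using qbracket_neq_0[of "Suc (2 * m)"] by (simp add: qfact_Suc qoddfact_Suc)
next
  case (Suc a)
  have "Suc (2 * Suc a) = Suc (Suc (Suc (2 * a)))" by simp
  then show ?case
    by (simp only: qdiff_qoddfact_Suc_Suc Suc.IH mult_zero_right)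
qed

text \<open>Doubling \<open>[2j]!\<close> cancels the q-Pochhammer weight and \<open>[j]!\<close>,
  so that only odd brackets remain.\<close>

lemma qsuper_catalan_div_qpoch:
  "1 / qpoch (- q) q j * qsuper_catalan q j m
    = qfact q (2 * m) / qfact q m * (qoddfact q j / qfact q (m + j))"
  using qfact_neq_0[of j] qpoch_neg_neq_0[of j]
  by (simp add: qsuper_catalan_def qfact_double[of j])

lemma alternating_qsuper_catalan_sum:
  assumes "m \<le> n"
  shows "(\<Sum>k=0..n - m. (-1) ^ k * q ^ (k * (k - 1) div 2) * (1 / qpoch (- q) q (n - k))
            * qbinom q (n - m) k * qsuper_catalan q (n - k) m)
         = (if even (n - m)
            then q ^ ((n\<^sup>2 - m\<^sup>2) div 2)
                   / (qpoch (- q) q ((n - m) div 2) * qpoch (- q) q ((n + m) div 2))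
                 * qbinom q (2 * m) m * inverse (qbinom q n m) * qbinom q n ((n - m) div 2)
            else 0)" (is "?lhs = ?rhs")
proof -
  obtain N where n: "n = m + N" using assms le_Suc_ex by blast
  have term_eq: "1 / qpoch (- q) q (n - k) * qsuper_catalan q (n - k) m
      = qfact q (2 * m) / qfact q m
        * (qoddfact q (m + (N - k)) / qfact q (2 * m + (N - k)))" if "k \<le> N" for k
    using that qsuper_catalan_div_qpoch[of "m + (N - k)" m] by (simp add: n mult_2 add.assoc)
  have "?lhs = (\<Sum>k=0..N. (-1) ^ k * q ^ (k * (k - 1) div 2) * qbinom q N k
      * (1 / qpoch (- q) q (n - k) * qsuper_catalan q (n - k) m))"
    by (simp add: n mult_ac)
  also have "\<dots> = (\<Sum>k=0..N. (-1) ^ k * q ^ (k * (k - 1) div 2) * qbinom q N k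
      * (qfact q (2 * m) / qfact q m
        * (qoddfact q (m + (N - k)) / qfact q (2 * m + (N - k)))))"
    by (rule sum.cong) (simp_all only: term_eq atLeastAtMost_iff)
  \<comment> \<open>The q-binomial expansion read backwards, with the factor independent of j pulled
    out.\<close>
  also have "\<dots> = qfact q (2 * m) / qfact q m
      * qdiff q N (\<lambda>j. qoddfact q (m + j) / qfact q (2 * m + j))"
    by (simp only: qdiff_eq_sum[symmetric] qdiff_cmult
        qdiff_eq_sum[of N "\<lambda>j. qfact q (2 * m) / qfact q m
          * (qoddfact q (m + j) / qfact q (2 * m + j))", symmetric])
  finally have lhs: "?lhs = qfact q (2 * m) / qfact q m
      * qdiff q N (\<lambda>j. qoddfact q (m + j) / qfact q (2 * m + j))" .
  show ?thesis
  proof (cases "even N")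
    case True
    then obtain a where N: "N = 2 * a" by blast
    \<comment> \<open>Here n = m + 2a, so the difference of squares is 4a(a + m) and halving it is
      exact.\<close>
    have "n\<^sup>2 - m\<^sup>2 = 2 * (2 * a * (a + m))"
      by (simp add: n N power2_eq_square algebra_simps)
    then have exponent: "(n\<^sup>2 - m\<^sup>2) div 2 = 2 * a * (a + m)" by simp
    have halves: "(n - m) div 2 = a" "(n + m) div 2 = a + m" "even (n - m)"
      using n N by simp_all
    have "2 * m - m = m" "n - m = 2 * a" "n - a = a + m" "m \<le> 2 * m" "a \<le> n"
      using n N by simp_all
    then have binoms: "qbinom q (2 * m) m = qfact q (2 * m) / (qfact q m * qfact q m)"
      "qbinom q n m = qfact q n / (qfact q m * qfact q (2 * a))"
      "qbinom q n a = qfact q n / (qfact q a * qfact q (a + m))"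
      using assms by (simp_all only: qbinom_def if_True)
    have "?rhs = q ^ (2 * a * (a + m)) / (qpoch (- q) q a * qpoch (- q) q (a + m))
        * (qfact q (2 * m) / (qfact q m * qfact q m))
        * inverse (qfact q n / (qfact q m * qfact q (2 * a)))
        * (qfact q n / (qfact q a * qfact q (a + m)))"
      by (simp only: exponent halves binoms if_True)
    \<comment> \<open>Doubling \<open>[2a]!\<close> supplies \<open>qoddfact q a\<close> and cancels
      \<open>qpoch (- q) q a\<close> and \<open>[a]!\<close>.\<close>
    also have "\<dots> = qfact q (2 * m) / qfact q m * (q ^ (2 * a * (a + m)) * qoddfact q a
        / (qpoch (- q) q (a + m) * qfact q (a + m)))"
      using qfact_neq_0[of m] qfact_neq_0[of n] qfact_neq_0[of a] qfact_neq_0[of "a + m"]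
        qpoch_neg_neq_0[of a] qpoch_neg_neq_0[of "a + m"]
      unfolding qfact_double[of a] by (simp add: mult_ac)
    finally show ?thesis
      by (simp only: lhs N qdiff_qoddfact_even)
  next
    case False
    then obtain a where N: "N = Suc (2 * a)" by (metis oddE Suc_eq_plus1)
    then show ?thesis
      by (simp only: lhs qdiff_qoddfact_odd) (simp add: n)
  qed
qed

end

theorem proposition3:
  fixes m n :: nat and q :: "'a::field_char_0 poly fract"
  assumes "m \<le> n"
  defines "q \<equiv> indet"
  shows "(\<Sum>k=0..n - m. (-1) ^ k * q ^ (k * (k - 1) div 2) * (1 / qpoch (- q) q (n - k))
            * qbinom q (n - m) k * qsuper_catalan q (n - k) m)
         = (if even (n - m)
            then q ^ ((n\<^sup>2 - m\<^sup>2) div 2)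
                   / (qpoch (- q) q ((n - m) div 2) * qpoch (- q) q ((n + m) div 2))
                 * qbinom q (2 * m) m * inverse (qbinom q n m) * qbinom q n ((n - m) div 2)
            else 0)"
  unfolding q_def
  by (rule alternating_qsuper_catalan_sum[OF indet_power_neq_1 assms(1)])

end
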